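(* Let $\Theta$ be an $r\times s$ matrix with real entries. The rows of $\Theta$ are inhomogeneously independent over $\mathbb{Q}$ if and only if ${}^{\ast}\mathbb{Z}^{s}/{}^{\ast}\mathbb{Z}^{s}(\Theta)\cong\mathbb{T}^{r}=\mathbb{R}^{r}/\mathbb{Z}^{r}$.
   Context: Fix a non-principal ultrafilter on $\mathbb{N}$; ${}^{\ast}\mathbb{Z}\subset{}^{\ast}\mathbb{R}$ are the ultrapowers of $\mathbb{Z}$, $\mathbb{R}$ and ${}^{\ast}\mathbb{R}_{\varepsilon}$ is the group of infinitesimals. Define $${}^{\ast}\mathbb{Z}^{s}(\Theta)=\{{}^{\ast}\boldsymbol{n}\in{}^{\ast}\mathbb{Z}^{s}\mid\exists\,{}^{\ast}\boldsymbol{n}^{\perp}\in{}^{\ast}\mathbb{Z}^{r}\text{ with }\Theta\,{}^{\ast}\boldsymbol{n}-{}^{\ast}\boldsymbol{n}^{\perp}\in{}^{\ast}\mathbb{R}_{\varepsilon}^{r}\}.$$ The rows $\Theta_{(1)},\dots,\Theta_{(r)}\in\mathbb{R}^{s}$ of $\Theta$ are inhomogeneously independent over $\mathbb{Q}$ if they together with the standard basis vectors of $\mathbb{R}^{s}$ form a set of $r+s$ vectors linearly independent over $\mathbb{Q}$. The isomorphism is one of groups. *)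

theory Defs
  imports "HOL-Analysis.Analysis" "HOL-Algebra.Product_Groups" "HOL-Algebra.Ring"
begin

definition nonprincipal_ultrafilter :: "'i filter \<Rightarrow> bool" where
  "nonprincipal_ultrafilter U \<longleftrightarrow>
     U \<noteq> bot \<and>
     (\<forall>P. (\<forall>\<^sub>F k in U. P k) \<or> (\<forall>\<^sub>F k in U. \<not> P k)) \<and>
     (\<forall>k. U \<noteq> principal {k})"

definition ultra_rel :: "nat filter \<Rightarrow> ((nat \<Rightarrow> 'a) \<times> (nat \<Rightarrow> 'a)) set" where
  "ultra_rel U = {(f, g). \<forall>\<^sub>F k in U. f k = g k}"

definition ultrapower :: "nat filter \<Rightarrow> (nat \<Rightarrow> 'a) set set" where
  "ultrapower U = UNIV // ultra_rel U"

definition ultra_class :: "nat filter \<Rightarrow> (nat \<Rightarrow> 'a) \<Rightarrow> (nat \<Rightarrow> 'a) set" where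
  "ultra_class U f = ultra_rel U `` {f}"

definition ultra_const :: "nat filter \<Rightarrow> 'a \<Rightarrow> (nat \<Rightarrow> 'a) set" where
  "ultra_const U a = ultra_class U (\<lambda>_. a)"

text \<open>
  Pointwise operations on sequences, lifted to classes. All representatives give the
  same class, so each union below is a union of copies of one class.
\<close>

definition ultra_map :: "nat filter \<Rightarrow> ('a \<Rightarrow> 'b) \<Rightarrow> (nat \<Rightarrow> 'a) set \<Rightarrow> (nat \<Rightarrow> 'b) set" where
  "ultra_map U h X = (\<Union>f\<in>X. ultra_class U (\<lambda>k. h (f k)))"

definition ultra_map2 ::
  "nat filter \<Rightarrow> ('a \<Rightarrow> 'b \<Rightarrow> 'c) \<Rightarrow> (nat \<Rightarrow> 'a) set \<Rightarrow> (nat \<Rightarrow> 'b) set \<Rightarrow> (nat \<Rightarrow> 'c) set" where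
  "ultra_map2 U h X Y = (\<Union>f\<in>X. \<Union>g\<in>Y. ultra_class U (\<lambda>k. h (f k) (g k)))"

definition ultra_less ::
  "nat filter \<Rightarrow> (nat \<Rightarrow> 'a::order) set \<Rightarrow> (nat \<Rightarrow> 'a) set \<Rightarrow> bool" where
  "ultra_less U X Y \<longleftrightarrow> (\<exists>f\<in>X. \<exists>g\<in>Y. \<forall>\<^sub>F k in U. f k < g k)"

definition ultra_ring :: "nat filter \<Rightarrow> (nat \<Rightarrow> 'a::comm_ring_1) set ring" where
  "ultra_ring U =
     \<lparr>carrier = ultrapower U,
      mult = ultra_map2 U (*),
      one = ultra_const U 1,
      zero = ultra_const U 0,
      add = ultra_map2 U (+)\<rparr>"

abbreviation hyperint :: "nat filter \<Rightarrow> (nat \<Rightarrow> int) set ring" where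
  "hyperint U \<equiv> ultra_ring U"

abbreviation hyperreal :: "nat filter \<Rightarrow> (nat \<Rightarrow> real) set ring" where
  "hyperreal U \<equiv> ultra_ring U"

text \<open>The inclusion of the hyperintegers into the hyperreals.\<close>

abbreviation hyper_of_int :: "nat filter \<Rightarrow> (nat \<Rightarrow> int) set \<Rightarrow> (nat \<Rightarrow> real) set" where
  "hyper_of_int U \<equiv> ultra_map U real_of_int"

definition infinitesimals :: "nat filter \<Rightarrow> (nat \<Rightarrow> real) set set" where
  "infinitesimals U =
     {x \<in> carrier (hyperreal U). \<forall>e>0. ultra_less U (ultra_map U abs x) (ultra_const U e)}"

definition hyperint_vectors :: "nat filter \<Rightarrow> ('n \<Rightarrow> (nat \<Rightarrow> int) set) monoid" where
  "hyperint_vectors U = product_group UNIV (\<lambda>_. add_monoid (hyperint U))"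

definition hyper_mat_vec ::
  "nat filter \<Rightarrow> real^'s^'r \<Rightarrow> ('s \<Rightarrow> (nat \<Rightarrow> int) set) \<Rightarrow> 'r \<Rightarrow> (nat \<Rightarrow> real) set" where
  "hyper_mat_vec U \<Theta> n i =
     (\<Oplus>\<^bsub>hyperreal U\<^esub>j\<in>UNIV. ultra_const U (\<Theta> $ i $ j) \<otimes>\<^bsub>hyperreal U\<^esub> hyper_of_int U (n j))"

definition diophantine_approximation_group ::
  "nat filter \<Rightarrow> real^'s^'r \<Rightarrow> ('s \<Rightarrow> (nat \<Rightarrow> int) set) set" where
  "diophantine_approximation_group U \<Theta> =
     {n \<in> carrier (hyperint_vectors U).
        \<exists>m \<in> carrier (hyperint_vectors U).
          \<forall>i. hyper_mat_vec U \<Theta> n i \<ominus>\<^bsub>hyperreal U\<^esub> hyper_of_int U (m i) \<in> infinitesimals U}"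

definition additive_group :: "'a::ab_group_add monoid" where
  "additive_group = \<lparr>carrier = UNIV, mult = (+), one = 0\<rparr>"

definition integer_lattice :: "(real^'r) set" where
  "integer_lattice = {v. \<forall>i. v $ i \<in> \<int>}"

definition torus :: "(real^'r) set monoid" where
  "torus = additive_group Mod integer_lattice"

text \<open>
  The library's dependent set, for the rational scalar action. The cardinality condition
  demands that the rows and the standard basis vectors be pairwise distinct, since a set
  does not record repetitions.
\<close>

definition inhomogeneously_independent :: "real^'s^'r \<Rightarrow> bool" where
  "inhomogeneously_independent \<Theta> \<longleftrightarrow>
     card (rows \<Theta> \<union> range (\<lambda>j. axis j 1)) = CARD('r) + CARD('s) \<and>
     \<not> module.dependent (\<lambda>(q::rat) v. of_rat q *\<^sub>R v) (rows \<Theta> \<union> range (\<lambda>j. axis j 1))"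

end

theory Submission
  imports Defs
begin

text \<open>
  Sending a hyperinteger vector \<open>n\<close> to the standard part of \<open>\<Theta> n\<close> modulo the integer lattice
  is a homomorphism into the torus: after subtracting integer parts the coordinates are bounded,
  so they converge along the ultrafilter, and the limit is determined up to integers. Its kernel
  is the Diophantine approximation group, by the very definition of that group, so the quotient
  always embeds into the torus (\<open>standard_part_mod_lattice_hom\<close>,
  \<open>kernel_standard_part_mod_lattice\<close>).

  Inhomogeneous independence says that no combination of the rows of \<open>\<Theta>\<close> with integer coefficients,
  not all zero, is an integer vector (\<open>inhomogeneously_independent_iff\<close>). Under this condition Kronecker's theorem makes
  the vectors \<open>\<Theta> n\<close>, for ordinary integer vectors \<open>n\<close>, dense modulo the lattice; a sequence of
  better and better approximations to a point of the torus represents a hyperinteger vector over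
  that point, so the embedding is onto. The matrix form of Kronecker's theorem follows from the
  continuous one for a single real parameter: choose a vector \<open>w\<close> generic enough that the
  coordinates of \<open>\<Theta> w\<close> and of \<open>w\<close> are jointly independent, and follow \<open>t w\<close> to a time at which
  \<open>t w\<close> is nearly an integer vector while \<open>\<Theta> (t w)\<close> is near the target modulo integers.

  Conversely, if a nonzero integer vector \<open>q\<close> combines the rows to an integer vector, then the
  image is confined to the points \<open>v\<close> of the torus at which \<open>q \<bullet> v\<close> is an integer. That the
  image is proper does not yet exclude an abstract isomorphism, but torsion does: for each \<open>N > 0\<close> the torus has only finitely many points of order
  dividing \<open>N\<close>, so every injective endomorphism of the torus permutes them. An isomorphism of
  the torus with the quotient would give such an endomorphism with all values in the confined
  image, whereas for \<open>N\<close> larger than the absolute value of a nonzero coefficient of \<open>q\<close> some point of order dividing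
  \<open>N\<close> lies outside it.
\<close>

section \<open>Rational independence as a condition on integer coefficients\<close>

text \<open>
  Independence of a set does not see repetitions, so for a family it has to be combined with
  injectivity; together they say that only the zero coefficients give the zero combination.
\<close>

lemma (in Modules.module) independent_range_iff:
  fixes f :: "'i::finite \<Rightarrow> 'b"
  shows "inj f \<and> independent (range f) \<longleftrightarrow> (\<forall>u. (\<Sum>i\<in>UNIV. scale (u i) (f i)) = 0 \<longrightarrow> (\<forall>i. u i = 0))"
    (is "?lhs \<longleftrightarrow> ?rhs")
proof
  assume L: ?lhs
  show ?rhs
  proof (intro allI impI)
    fix u i assume eq: "(\<Sum>i\<in>UNIV. scale (u i) (f i)) = 0"
    have "(\<Sum>v\<in>range f. scale (u (Hilbert_Choice.inv f v)) v) = (\<Sum>i\<in>UNIV. scale (u i) (f i))"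
      using L by (simp add: sum.reindex)
    then show "u i = 0"
      using L eq independentD[of "range f" "range f" "\<lambda>v. u (Hilbert_Choice.inv f v)" "f i"] by simp
  qed
next
  assume R: ?rhs
  have inj: "inj f"
  proof (rule injI, rule ccontr)
    fix x y assume "f x = f y" "x \<noteq> y"
    define u where "u = (\<lambda>i. (if i = x then 1 else 0) - (if i = y then 1 else 0 :: 'a))"
    have "(\<Sum>i\<in>UNIV. scale (u i) (f i)) = f x - f y"
      by (simp add: u_def scale_left_diff_distrib sum_subtractf if_distrib[where f="\<lambda>a. scale a _"] cong: if_cong)
    with R \<open>f x = f y\<close> have "u x = 0" by auto
    with \<open>x \<noteq> y\<close> show False by (simp add: u_def)
  qed
  moreover have "independent (range f)"
    unfolding dependent_finite[OF finite_imageI[OF finite]]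
  proof safe
    fix u i assume "(\<Sum>v\<in>range f. scale (u v) v) = 0" "u (f i) \<noteq> 0"
    with inj R[rule_format, of "u \<circ> f" i] show False
      by (simp add: sum.reindex)
  qed
  ultimately show ?lhs by blast
qed

text \<open>
  For families of real vectors, integer and rational coefficients give the same notion, since
  denominators can be cleared. Kronecker's theorem uses the integer form.
\<close>

definition integrally_independent :: "('i::finite \<Rightarrow> 'a::real_vector) \<Rightarrow> bool" where
  "integrally_independent f \<longleftrightarrow>
     (\<forall>u. (\<Sum>i\<in>UNIV. of_int (u i) *\<^sub>R f i) = 0 \<longrightarrow> (\<forall>i. u i = 0))"

lemma rat_common_denominator:
  fixes u :: "'i::finite \<Rightarrow> rat"
  obtains d :: int and z :: "'i \<Rightarrow> int" where "d > 0" "\<And>i. of_int d * u i = of_int (z i)"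
proof -
  define b where "b i = snd (quotient_of (u i))" for i
  have b: "b i > 0" "of_int (b i) * u i = of_int (fst (quotient_of (u i)))" for i
    using quotient_of_denom_pos'[of "u i"] quotient_of_div[of "u i" "fst (quotient_of (u i))" "b i"]
    by (auto simp: b_def field_simps)
  define d where "d = (\<Prod>i\<in>UNIV. b i)"
  have "\<exists>z::int. of_int d * u i = of_int z" for i
  proof -
    have "d = (\<Prod>i\<in>UNIV-{i}. b i) * b i"
      by (simp add: d_def prod.remove[of UNIV i] mult.commute)
    then have "of_int d * u i = of_int ((\<Prod>i\<in>UNIV-{i}. b i) * fst (quotient_of (u i)))"
      using b(2)[of i] by (simp only: of_int_mult mult.assoc)
    then show ?thesis by blast
  qed
  then obtain z where "\<And>i. of_int d * u i = (of_int (z i) :: rat)" by metis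
  moreover have "d > 0" using b by (simp add: d_def prod_pos)
  ultimately show thesis using that by blast
qed

lemma rationally_independent_iff_integrally_independent:
  fixes f :: "'i::finite \<Rightarrow> 'a::real_vector"
  shows "(\<forall>u. (\<Sum>i\<in>UNIV. of_rat (u i) *\<^sub>R f i) = 0 \<longrightarrow> (\<forall>i. u i = 0)) \<longleftrightarrow> integrally_independent f"
proof
  assume L: "\<forall>u. (\<Sum>i\<in>UNIV. of_rat (u i) *\<^sub>R f i) = 0 \<longrightarrow> (\<forall>i. u i = 0)"
  show "integrally_independent f"
    unfolding integrally_independent_def
  proof (intro allI impI)
    fix u :: "'i \<Rightarrow> int" and i
    assume "(\<Sum>i\<in>UNIV. of_int (u i) *\<^sub>R f i) = 0"
    with L[rule_format, of "\<lambda>i. of_int (u i)" i] show "u i = 0" by simp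
  qed
next
  assume R: "integrally_independent f"
  show "\<forall>u. (\<Sum>i\<in>UNIV. of_rat (u i) *\<^sub>R f i) = 0 \<longrightarrow> (\<forall>i. u i = 0)"
  proof (intro allI impI)
    fix u i assume eq: "(\<Sum>i\<in>UNIV. of_rat (u i) *\<^sub>R f i) = 0"
    obtain d z where d: "d > (0::int)" "\<And>i. of_int d * u i = of_int (z i)"
      using rat_common_denominator by blast
    have z: "of_int (z i) = of_int d * (of_rat (u i) :: real)" for i
      by (metis d(2) of_rat_mult of_rat_of_int_eq)
    have "(\<Sum>i\<in>UNIV. of_int (z i) *\<^sub>R f i) = of_int d *\<^sub>R (\<Sum>i\<in>UNIV. of_rat (u i) *\<^sub>R f i)"
      by (simp only: z scaleR_sum_right scaleR_scaleR)
    with eq R have "z i = 0" by (simp add: integrally_independent_def)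
    with d show "u i = 0" by (metis mult_eq_0_iff of_int_0 of_int_0_eq_iff less_irrefl)
  qed
qed

abbreviation rows_and_axes :: "real^'s^'r \<Rightarrow> 'r + 's \<Rightarrow> real^'s" where
  "rows_and_axes \<Theta> \<equiv> case_sum (\<lambda>i. row i \<Theta>) (\<lambda>j. axis j 1)"

lemma inhomogeneously_independent_iff_integrally_independent:
  "inhomogeneously_independent \<Theta> \<longleftrightarrow> integrally_independent (rows_and_axes \<Theta>)"
proof -
  interpret rat: Modules.module "\<lambda>(q::rat) (v::real^'s). of_rat q *\<^sub>R v"
    by unfold_locales (simp_all add: scaleR_right_distrib scaleR_left_distrib of_rat_add of_rat_mult)
  have range: "rows \<Theta> \<union> range (\<lambda>j. axis j 1) = range (rows_and_axes \<Theta>)"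
    by (simp add: rows_def UNIV_sum image_Un image_image full_SetCompr_eq)
  have "card (range (rows_and_axes \<Theta>)) = CARD('b) + CARD('a) \<longleftrightarrow> inj (rows_and_axes \<Theta>)"
    using card_image[of "rows_and_axes \<Theta>" UNIV] eq_card_imp_inj_on[of UNIV "rows_and_axes \<Theta>"]
    by (auto simp: card_UNIV_sum)
  then show ?thesis
    unfolding inhomogeneously_independent_def range
    using rat.independent_range_iff[of "rows_and_axes \<Theta>"]
      rationally_independent_iff_integrally_independent[of "rows_and_axes \<Theta>"] by simp
qed

lemma sum_rows_and_axes_nth:
  "(\<Sum>x\<in>UNIV. of_int (u x) *\<^sub>R rows_and_axes \<Theta> x) $ j =
   (\<Sum>i\<in>UNIV. of_int (u (Inl i)) * \<Theta> $ i $ j) + of_int (u (Inr j))"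
  by (subst UNIV_Plus_UNIV[symmetric], subst sum.Plus)
    (simp_all add: row_def axis_def if_distrib[where f="\<lambda>a. _ * a"] cong: if_cong)

text \<open>
  The coefficients of the standard basis vectors can absorb any integer vector, so they
  drop out: only the combinations of the rows modulo integer vectors matter.
\<close>

lemma inhomogeneously_independent_iff:
  "inhomogeneously_independent \<Theta> \<longleftrightarrow>
   (\<forall>q::'r \<Rightarrow> int. (\<forall>j. (\<Sum>i\<in>UNIV. of_int (q i) * \<Theta> $ i $ j) \<in> \<int>) \<longrightarrow> (\<forall>i. q i = 0))"
  for \<Theta> :: "real^'s^'r"
  unfolding inhomogeneously_independent_iff_integrally_independent
proof
  assume ind: "integrally_independent (rows_and_axes \<Theta>)"
  show "\<forall>q::'r \<Rightarrow> int. (\<forall>j. (\<Sum>i\<in>UNIV. of_int (q i) * \<Theta> $ i $ j) \<in> \<int>) \<longrightarrow> (\<forall>i. q i = 0)"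
  proof (intro allI impI)
    fix q :: "'r \<Rightarrow> int" and i
    assume "\<forall>j. (\<Sum>i\<in>UNIV. of_int (q i) * \<Theta> $ i $ j) \<in> \<int>"
    then obtain p where p: "\<And>j. (\<Sum>i\<in>UNIV. of_int (q i) * \<Theta> $ i $ j) = of_int (p j)"
      unfolding Ints_def image_iff Bex_def by metis
    let ?u = "case_sum q (\<lambda>j. - p j)"
    have "(\<Sum>x\<in>UNIV. of_int (?u x) *\<^sub>R rows_and_axes \<Theta> x) = 0"
      unfolding vec_eq_iff by (simp only: sum_rows_and_axes_nth) (simp add: p)
    with ind have "?u (Inl i) = 0"
      unfolding integrally_independent_def by blast
    then show "q i = 0" by simp
  qed
next
  assume R: "\<forall>q::'r \<Rightarrow> int. (\<forall>j. (\<Sum>i\<in>UNIV. of_int (q i) * \<Theta> $ i $ j) \<in> \<int>) \<longrightarrow> (\<forall>i. q i = 0)"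
  show "integrally_independent (rows_and_axes \<Theta>)"
    unfolding integrally_independent_def
  proof (intro allI impI)
    fix u x assume "(\<Sum>x\<in>UNIV. of_int (u x) *\<^sub>R rows_and_axes \<Theta> x) = 0"
    then have eq: "(\<Sum>i\<in>UNIV. of_int (u (Inl i)) * \<Theta> $ i $ j) = of_int (- u (Inr j))" for j
      unfolding vec_eq_iff sum_rows_and_axes_nth by (simp add: add_eq_0_iff2)
    have Inl: "u (Inl i) = 0" for i
      using R[rule_format, of "\<lambda>i. u (Inl i)" i] unfolding eq by (simp only: Ints_of_int)
    with eq have "u (Inr j) = 0" for j by simp
    with Inl show "u x = 0" by (cases x) auto
  qed
qed

section \<open>Kronecker's theorem for matrices\<close>

text \<open>
  Each nonzero integer combination of the \<open>f i\<close> is orthogonal to the vectors of a hyperplane only.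
  There are countably many combinations, and countably many null sets do not fill the space.
\<close>

lemma integrally_independent_inner_generic:
  fixes f :: "'i::finite \<Rightarrow> 'a::euclidean_space"
  assumes "integrally_independent f"
  obtains w where "integrally_independent (\<lambda>i. f i \<bullet> w)"
proof -
  define a where "a u = (\<Sum>i\<in>UNIV. of_int (u i) *\<^sub>R f i)" for u :: "'i \<Rightarrow> int"
  have "negligible (\<Union>u\<in>{u. a u \<noteq> 0}. {w. a u \<bullet> w = 0})"
    by (intro negligible_countable_Union) (auto intro: negligible_hyperplane)
  then obtain w where w: "w \<notin> (\<Union>u\<in>{u. a u \<noteq> 0}. {w. a u \<bullet> w = 0})"
    using non_negligible_UNIV by (metis UNIV_eq_I)
  have "integrally_independent (\<lambda>i. f i \<bullet> w)"
    unfolding integrally_independent_def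
  proof (rule allI, rule impI)
    fix u :: "'i \<Rightarrow> int"
    assume "(\<Sum>i\<in>UNIV. of_int (u i) *\<^sub>R (f i \<bullet> w)) = 0"
    then have "a u \<bullet> w = 0" by (simp add: a_def inner_sum_left)
    with w have "a u = 0" by auto
    with assms show "\<forall>i. u i = 0" by (simp add: a_def integrally_independent_def)
  qed
  with that show thesis .
qed

text \<open>
  Kronecker's theorem for a continuous parameter, transported from initial segments of the
  natural numbers to an arbitrary finite index type.
\<close>

lemma Kronecker_flow:
  fixes \<theta> \<alpha> :: "'i::finite \<Rightarrow> real"
  assumes "integrally_independent \<theta>" "\<epsilon> > 0"
  obtains t h where "\<And>i. \<bar>t * \<theta> i - of_int (h i) - \<alpha> i\<bar> < \<epsilon>"
proof -
  interpret int: Modules.module "\<lambda>r. (*) (real_of_int r)"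
    by unfold_locales (simp_all add: algebra_simps)
  have ind: "inj \<theta>" "int.independent (range \<theta>)"
    using assms(1) int.independent_range_iff[of \<theta>] by (simp_all add: integrally_independent_def)
  obtain e where e: "bij_betw e {..<CARD('i)} (UNIV :: 'i set)"
    using ex_bij_betw_nat_finite[of "UNIV :: 'i set"] by (auto simp: atLeast0LessThan)
  have "inj_on (\<theta> \<circ> e) {..<CARD('i)}" "int.independent ((\<theta> \<circ> e) ` {..<CARD('i)})"
    using e ind by (auto simp only: bij_betw_def image_comp[symmetric] intro!: comp_inj_on)
  then obtain t h where th: "\<And>k. k < CARD('i) \<Longrightarrow> \<bar>t * (\<theta> \<circ> e) k - of_int (h k) - (\<alpha> \<circ> e) k\<bar> < \<epsilon>"
    using Kronecker_thm_1[where \<theta>="\<theta> \<circ> e" and \<alpha>="\<alpha> \<circ> e" and n="CARD('i)" and \<epsilon>=\<epsilon>] assms(2) by blast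
  show thesis
  proof
    fix i
    obtain k where "k < CARD('i)" "e k = i" using e by (metis bij_betw_iff_bijections UNIV_I lessThan_iff)
    moreover from this e have "inv_into {..<CARD('i)} e i = k"
      by (metis bij_betw_inv_into_left lessThan_iff)
    ultimately show "\<bar>t * \<theta> i - of_int ((h \<circ> inv_into {..<CARD('i)} e) i) - \<alpha> i\<bar> < \<epsilon>"
      using th[of k] by simp
  qed
qed

text \<open>
  Along the line of multiples of a generic \<open>w\<close>, the flow theorem controls \<open>t * (\<Theta> w)\<close> and
  \<open>t * w\<close> modulo integers simultaneously. Steering the second to \<open>0\<close> replaces the real vector
  \<open>t * w\<close> by a nearby integer vector, at the cost of an error bounded by the entries of \<open>\<Theta>\<close>.
\<close>

theorem Kronecker_matrix:
  fixes \<Theta> :: "real^'s^'r" and \<alpha> :: "'r \<Rightarrow> real"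
  assumes "inhomogeneously_independent \<Theta>" "\<epsilon> > 0"
  obtains n m where "\<And>i. \<bar>(\<Sum>j\<in>UNIV. \<Theta> $ i $ j * of_int (n j)) - of_int (m i) - \<alpha> i\<bar> < \<epsilon>"
proof -
  obtain w where w: "integrally_independent (\<lambda>x. rows_and_axes \<Theta> x \<bullet> w)"
    using assms(1) integrally_independent_inner_generic
    unfolding inhomogeneously_independent_iff_integrally_independent by blast
  \<comment> \<open>\<open>1\<close> pays for the error of the flow itself, the entries of \<open>\<Theta>\<close> for rounding \<open>t * w\<close>.\<close>
  define C where "C = 1 + (\<Sum>i\<in>UNIV. \<Sum>j\<in>UNIV. \<bar>\<Theta> $ i $ j\<bar>)"
  have "C > 0" unfolding C_def by (intro add_pos_nonneg sum_nonneg) auto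
  have C: "1 + (\<Sum>j\<in>UNIV. \<bar>\<Theta> $ i $ j\<bar>) \<le> C" for i
    unfolding C_def by (simp add: member_le_sum[of i UNIV "\<lambda>i. \<Sum>j\<in>UNIV. \<bar>\<Theta> $ i $ j\<bar>"] sum_nonneg)
  define \<delta> where "\<delta> = \<epsilon> / C"
  have "\<delta> > 0" using assms(2) \<open>C > 0\<close> by (simp add: \<delta>_def)
  then obtain t h where th:
    "\<And>x. \<bar>t * (rows_and_axes \<Theta> x \<bullet> w) - of_int (h x) - case_sum \<alpha> (\<lambda>_. 0) x\<bar> < \<delta>"
    using Kronecker_flow[OF w] by blast
  show thesis
  proof
    fix i
    have near: "\<bar>of_int (h (Inr j)) - t * w $ j\<bar> \<le> \<delta>" for j
      using th[of "Inr j"] by (simp add: inner_axis' abs_minus_commute)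
    have flow: "\<bar>t * (\<Sum>j\<in>UNIV. \<Theta> $ i $ j * w $ j) - of_int (h (Inl i)) - \<alpha> i\<bar> < \<delta>"
      using th[of "Inl i"] by (simp add: inner_vec_def row_def)
    have "(\<Sum>j\<in>UNIV. \<Theta> $ i $ j * of_int (h (Inr j))) - t * (\<Sum>j\<in>UNIV. \<Theta> $ i $ j * w $ j) =
        (\<Sum>j\<in>UNIV. \<Theta> $ i $ j * (of_int (h (Inr j)) - t * w $ j))"
      by (simp add: sum_distrib_left sum_subtractf algebra_simps)
    also have "\<bar>\<dots>\<bar> \<le> (\<Sum>j\<in>UNIV. \<bar>\<Theta> $ i $ j\<bar> * \<delta>)"
      by (rule order_trans[OF sum_abs]) (intro sum_mono, simp add: abs_mult near mult_left_mono)
    finally have "\<bar>(\<Sum>j\<in>UNIV. \<Theta> $ i $ j * of_int (h (Inr j))) - of_int (h (Inl i)) - \<alpha> i\<bar>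
        < \<delta> + (\<Sum>j\<in>UNIV. \<bar>\<Theta> $ i $ j\<bar>) * \<delta>"
      unfolding sum_distrib_right using flow by linarith
    also have "\<dots> = (1 + (\<Sum>j\<in>UNIV. \<bar>\<Theta> $ i $ j\<bar>)) * \<delta>"
      by (simp add: algebra_simps)
    also have "\<dots> \<le> C * \<delta>" using C \<open>\<delta> > 0\<close> by (simp add: mult_right_mono)
    also have "\<dots> = \<epsilon>" using \<open>C > 0\<close> by (simp add: \<delta>_def)
    finally show "\<bar>(\<Sum>j\<in>UNIV. \<Theta> $ i $ j * of_int (h (Inr j))) - of_int (h (Inl i)) - \<alpha> i\<bar> < \<epsilon>" .
  qed
qed

section \<open>Computing in ultrapowers with representatives\<close>

lemma in_ultra_class_iff: "g \<in> ultra_class U f \<longleftrightarrow> (\<forall>\<^sub>F k in U. f k = g k)"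
  by (simp add: ultra_class_def ultra_rel_def)

lemma ultra_class_eq_iff [simp]:
  "ultra_class U f = ultra_class U g \<longleftrightarrow> (\<forall>\<^sub>F k in U. f k = g k)"
proof
  assume "ultra_class U f = ultra_class U g"
  moreover have "g \<in> ultra_class U g" by (simp add: in_ultra_class_iff)
  ultimately have "g \<in> ultra_class U f" by simp
  then show "\<forall>\<^sub>F k in U. f k = g k" by (simp add: in_ultra_class_iff)
next
  assume eq: "\<forall>\<^sub>F k in U. f k = g k"
  have "(\<forall>\<^sub>F k in U. f k = h k) \<longleftrightarrow> (\<forall>\<^sub>F k in U. g k = h k)" for h
    by (rule eventually_cong[OF eq]) simp
  then show "ultra_class U f = ultra_class U g" by (simp add: set_eq_iff in_ultra_class_iff)
qed

lemma ultrapower_eq: "ultrapower U = range (ultra_class U)"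
  by (auto simp: ultrapower_def quotient_def ultra_class_def)

lemma ultra_map_class [simp]:
  "ultra_map U h (ultra_class U f) = ultra_class U (\<lambda>k. h (f k))"
proof -
  have "ultra_class U (\<lambda>k. h (g k)) = ultra_class U (\<lambda>k. h (f k))" if "g \<in> ultra_class U f" for g
    using that by (auto simp: in_ultra_class_iff elim: eventually_mono)
  moreover have "f \<in> ultra_class U f" by (simp add: in_ultra_class_iff)
  ultimately show ?thesis unfolding ultra_map_def by blast
qed

lemma ultra_map2_class [simp]:
  "ultra_map2 U h (ultra_class U f) (ultra_class U g) = ultra_class U (\<lambda>k. h (f k) (g k))"
proof -
  have "ultra_class U (\<lambda>k. h (f' k) (g' k)) = ultra_class U (\<lambda>k. h (f k) (g k))"
    if "f' \<in> ultra_class U f" "g' \<in> ultra_class U g" for f' g'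
    using that by (auto simp: in_ultra_class_iff elim: eventually_elim2)
  moreover have "f \<in> ultra_class U f" "g \<in> ultra_class U g" by (simp_all add: in_ultra_class_iff)
  ultimately show ?thesis unfolding ultra_map2_def by blast
qed

lemma ultra_less_class [simp]:
  "ultra_less U (ultra_class U f) (ultra_class U g) \<longleftrightarrow> (\<forall>\<^sub>F k in U. f k < g k)"
proof
  assume "ultra_less U (ultra_class U f) (ultra_class U g)"
  then obtain f' g' where "\<forall>\<^sub>F k in U. f k = f' k" "\<forall>\<^sub>F k in U. g k = g' k" "\<forall>\<^sub>F k in U. f' k < g' k"
    by (auto simp: ultra_less_def in_ultra_class_iff)
  then show "\<forall>\<^sub>F k in U. f k < g k" by eventually_elim simp
next
  assume "\<forall>\<^sub>F k in U. f k < g k"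
  then show "ultra_less U (ultra_class U f) (ultra_class U g)"
    unfolding ultra_less_def
    by (intro bexI[of _ f] bexI[of _ g]) (simp_all add: in_ultra_class_iff)
qed

lemma ultra_ring_simps [simp]:
  "carrier (ultra_ring U) = range (ultra_class U)"
  "ultra_class U f \<oplus>\<^bsub>ultra_ring U\<^esub> ultra_class U g = ultra_class U (\<lambda>k. f k + g k)"
  "ultra_class U f \<otimes>\<^bsub>ultra_ring U\<^esub> ultra_class U g = ultra_class U (\<lambda>k. f k * g k)"
  "\<zero>\<^bsub>ultra_ring U\<^esub> = ultra_class U (\<lambda>_. 0)"
  by (simp_all add: ultra_ring_def ultrapower_eq ultra_const_def)

lemma ultra_class_in_range [simp]: "ultra_class U f \<in> range (ultra_class U)"
  by blast

lemma abelian_group_ultra_ring: "abelian_group (ultra_ring U)"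
proof (rule abelian_groupI)
  fix x :: "(nat \<Rightarrow> 'a) set" assume "x \<in> carrier (ultra_ring U)"
  then obtain f where "x = ultra_class U f" by auto
  then show "\<exists>y\<in>carrier (ultra_ring U). y \<oplus>\<^bsub>ultra_ring U\<^esub> x = \<zero>\<^bsub>ultra_ring U\<^esub>"
    by (intro bexI[of _ "ultra_class U (\<lambda>k. - f k)"]) simp_all
qed (auto simp: algebra_simps)

lemma ultra_ring_minus [simp]:
  "ultra_class U f \<ominus>\<^bsub>ultra_ring U\<^esub> ultra_class U g = ultra_class U (\<lambda>k. f k - g k)"
proof -
  interpret abelian_group "ultra_ring U" by (rule abelian_group_ultra_ring)
  have "\<ominus>\<^bsub>ultra_ring U\<^esub> ultra_class U g = ultra_class U (\<lambda>k. - g k)"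
    by (rule minus_equality) simp_all
  then show ?thesis by (simp add: a_minus_def)
qed

lemma ultra_ring_finsum:
  assumes "finite A"
  shows "(\<Oplus>\<^bsub>ultra_ring U\<^esub>a\<in>A. ultra_class U (f a)) = ultra_class U (\<lambda>k. \<Sum>a\<in>A. f a k)"
proof -
  interpret abelian_group "ultra_ring U" by (rule abelian_group_ultra_ring)
  from assms show ?thesis
    by induction (simp_all add: finsum_insert Pi_iff)
qed

lemma infinitesimals_class:
  "ultra_class U f \<in> infinitesimals U \<longleftrightarrow> (f \<longlongrightarrow> 0) U"
  by (simp add: infinitesimals_def ultra_const_def tendsto_iff dist_real_def)

lemma carrier_hyperint_vectors:
  "carrier (hyperint_vectors U) = range (\<lambda>f j. ultra_class U (f j))"
proof -
  have "n \<in> range (\<lambda>f j. ultra_class U (f j))" if "\<And>j. n j \<in> range (ultra_class U)" 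
    for n :: "'a \<Rightarrow> (nat \<Rightarrow> int) set"
  proof -
    from that obtain f where "\<And>j. n j = ultra_class U (f j)" unfolding image_iff Bex_def by metis
    then have "n = (\<lambda>j. ultra_class U (f j))" by blast
    then show ?thesis by blast
  qed
  then show ?thesis by (auto simp: hyperint_vectors_def PiE_def Pi_iff)
qed

lemma group_hyperint_vectors: "group (hyperint_vectors U)"
  unfolding hyperint_vectors_def
  by (intro product_group abelian_group.a_group abelian_group_ultra_ring)

lemma mult_hyperint_vectors [simp]:
  "(\<lambda>j. ultra_class U (f j)) \<otimes>\<^bsub>hyperint_vectors U\<^esub> (\<lambda>j. ultra_class U (g j))
   = (\<lambda>j. ultra_class U (\<lambda>k. f j k + g j k))"
  by (simp add: hyperint_vectors_def restrict_UNIV)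

lemma hyper_mat_vec_class [simp]:
  "hyper_mat_vec U \<Theta> (\<lambda>j. ultra_class U (f j)) i =
   ultra_class U (\<lambda>k. \<Sum>j\<in>UNIV. \<Theta> $ i $ j * of_int (f j k))"
  by (simp add: hyper_mat_vec_def ultra_const_def ultra_ring_finsum)

lemma diophantine_approximation_group_class:
  "(\<lambda>j. ultra_class U (f j)) \<in> diophantine_approximation_group U \<Theta> \<longleftrightarrow>
   (\<exists>m. \<forall>i. ((\<lambda>k. (\<Sum>j\<in>UNIV. \<Theta> $ i $ j * of_int (f j k)) - of_int (m i k)) \<longlongrightarrow> 0) U)"
  by (auto simp: diophantine_approximation_group_def carrier_hyperint_vectors infinitesimals_class)

section \<open>Limits along an ultrafilter\<close>

text \<open>
  An ultrafilter containing a singleton would be principal, so all cofinite sets belong to it.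
  The limit of an ordinary sequence is hence also its limit along the ultrafilter.
\<close>

lemma nonprincipal_ultrafilter_le_sequentially:
  assumes "nonprincipal_ultrafilter U"
  shows "U \<le> sequentially"
proof -
  have U: "U \<noteq> bot" "\<And>P. (\<forall>\<^sub>F k in U. P k) \<or> (\<forall>\<^sub>F k in U. \<not> P k)" "\<And>k. U \<noteq> principal {k}"
    using assms unfolding nonprincipal_ultrafilter_def by blast+
  have ne: "\<forall>\<^sub>F k in U. k \<noteq> a" for a
  proof (rule ccontr)
    assume "\<not> (\<forall>\<^sub>F k in U. k \<noteq> a)"
    then have a: "\<forall>\<^sub>F k in U. k = a" using U(2)[of "\<lambda>k. k = a"] by blast
    have "eventually P U \<longleftrightarrow> P a" for P
    proof
      assume "eventually P U"
      with a have "\<forall>\<^sub>F k in U. P a" by eventually_elim simp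
      with U(1) show "P a" by (simp add: eventually_const)
    next
      assume "P a"
      with a show "eventually P U" by (auto elim: eventually_mono)
    qed
    then have "U = principal {a}" by (simp add: filter_eq_iff eventually_principal)
    with U(3) show False by blast
  qed
  have ge: "\<forall>\<^sub>F k in U. N \<le> k" for N
  proof (induction N)
    case (Suc N)
    with ne[of N] show ?case by eventually_elim simp
  qed simp
  show ?thesis
    by (rule filter_leI) (auto simp: eventually_sequentially intro: eventually_mono[OF ge])
qed

text \<open>
  By compactness the values have a cluster point along the filter, and along an ultrafilter a
  cluster point is a limit: a neighbourhood that is not eventually entered is eventually avoided.
\<close>

lemma ultrafilter_bounded_convergent:
  fixes f :: "'i \<Rightarrow> 'a::heine_borel"
  assumes U: "nonprincipal_ultrafilter U" and "bounded (range f)"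
  obtains l where "(f \<longlongrightarrow> l) U"
proof -
  have "compact (closure (range f))" using assms(2) by simp
  moreover have "filtermap f U \<noteq> bot" using U by (simp add: nonprincipal_ultrafilter_def filtermap_bot_iff)
  moreover have "eventually (\<lambda>x. x \<in> closure (range f)) (filtermap f U)"
    unfolding eventually_filtermap
    by (intro always_eventually allI subsetD[OF closure_subset] rangeI)
  ultimately obtain l where l: "inf (nhds l) (filtermap f U) \<noteq> bot"
    unfolding compact_filter by blast
  have "(f \<longlongrightarrow> l) U"
  proof (rule topological_tendstoI, rule ccontr)
    fix S assume S: "open S" "l \<in> S" "\<not> (\<forall>\<^sub>F x in U. f x \<in> S)"
    moreover have "(\<forall>\<^sub>F x in U. P x) \<or> (\<forall>\<^sub>F x in U. \<not> P x)" for P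
      using U unfolding nonprincipal_ultrafilter_def by (elim conjE) (erule spec)
    ultimately have "\<forall>\<^sub>F x in U. f x \<notin> S" by blast
    then have "eventually (\<lambda>y. y \<notin> S) (filtermap f U)" by (simp add: eventually_filtermap)
    moreover have "eventually (\<lambda>y. y \<in> S) (nhds l)" using S eventually_nhds by blast
    ultimately have "eventually (\<lambda>_. False) (inf (nhds l) (filtermap f U))"
      unfolding eventually_inf by blast
    with l show False by (simp add: eventually_False)
  qed
  with that show thesis .
qed

section \<open>The torus and its torsion\<close>

lemma comm_group_additive_group: "comm_group (additive_group :: 'a::ab_group_add monoid)"
proof (rule comm_groupI)
  fix x :: 'a
  show "\<exists>y\<in>carrier additive_group. y \<otimes>\<^bsub>additive_group\<^esub> x = \<one>\<^bsub>additive_group\<^esub>"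
    by (auto simp: additive_group_def intro!: exI[of _ "- x"])
qed (auto simp: additive_group_def algebra_simps)

lemma subgroup_integer_lattice: "subgroup integer_lattice additive_group"
proof (rule group.subgroupI)
  show "group (additive_group :: (real^'r) monoid)"
    using comm_group_additive_group comm_group_def by blast
  fix a :: "real^'r" assume a: "a \<in> integer_lattice"
  have "inv\<^bsub>additive_group\<^esub> a = - a"
    by (rule group.inv_equality[OF \<open>group additive_group\<close>]) (auto simp: additive_group_def)
  with a show "inv\<^bsub>additive_group\<^esub> a \<in> integer_lattice"
    by (simp add: integer_lattice_def)
next
  have "0 \<in> (integer_lattice :: (real^'r) set)" by (simp add: integer_lattice_def)
  then show "integer_lattice \<noteq> ({} :: (real^'r) set)" by blast
qed (auto simp: additive_group_def integer_lattice_def)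

lemma normal_integer_lattice: "integer_lattice \<lhd> additive_group"
  by (simp add: comm_group.normal_iff_subgroup comm_group_additive_group subgroup_integer_lattice)

lemma group_torus: "group torus"
  unfolding torus_def by (rule normal.factorgroup_is_group[OF normal_integer_lattice])

definition lattice_coset :: "real^'r \<Rightarrow> (real^'r) set" where
  "lattice_coset v = integer_lattice #>\<^bsub>additive_group\<^esub> v"

lemma in_lattice_coset_iff: "w \<in> lattice_coset v \<longleftrightarrow> (\<forall>i. w $ i - v $ i \<in> \<int>)"
proof
  assume R: "\<forall>i. w $ i - v $ i \<in> \<int>"
  have "w = (w - v) + v" by simp
  moreover have "w - v \<in> integer_lattice" using R by (simp add: integer_lattice_def)
  ultimately show "w \<in> lattice_coset v"
    unfolding lattice_coset_def r_coset_def additive_group_def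
    by (auto intro!: bexI[of _ "w - v"])
qed (auto simp: lattice_coset_def r_coset_def additive_group_def integer_lattice_def)

lemma lattice_coset_eq_iff: "lattice_coset v = lattice_coset w \<longleftrightarrow> (\<forall>i. v $ i - w $ i \<in> \<int>)"
proof
  assume "lattice_coset v = lattice_coset w"
  moreover have "v \<in> lattice_coset v" by (simp add: in_lattice_coset_iff)
  ultimately show "\<forall>i. v $ i - w $ i \<in> \<int>" by (simp add: in_lattice_coset_iff)
next
  assume *: "\<forall>i. v $ i - w $ i \<in> \<int>"
  have "u $ i - v $ i \<in> \<int> \<longleftrightarrow> u $ i - w $ i \<in> \<int>" for u i
    using Ints_add[of "u $ i - v $ i" "v $ i - w $ i"] Ints_diff[of "u $ i - w $ i" "v $ i - w $ i"] *
    by auto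
  then show "lattice_coset v = lattice_coset w" by (simp add: set_eq_iff in_lattice_coset_iff)
qed

lemma carrier_torus: "carrier torus = range lattice_coset"
  by (auto simp: torus_def carrier_FactGroup lattice_coset_def additive_group_def)

lemma one_torus: "\<one>\<^bsub>torus\<^esub> = lattice_coset 0"
  by (auto simp: torus_def in_lattice_coset_iff integer_lattice_def)

lemma mult_torus: "lattice_coset v \<otimes>\<^bsub>torus\<^esub> lattice_coset w = lattice_coset (v + w)"
  using normal.rcos_sum[OF normal_integer_lattice, of v w]
  by (simp add: torus_def lattice_coset_def additive_group_def)

lemma pow_torus: "lattice_coset v [^]\<^bsub>torus\<^esub> (N::nat) = lattice_coset (of_nat N *\<^sub>R v)"
proof (induction N)
  case (Suc N)
  then show ?case by (simp add: mult_torus scaleR_left_distrib add.commute)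
qed (simp add: one_torus)

lemma pow_torus_eq_one_iff:
  "lattice_coset v [^]\<^bsub>torus\<^esub> (N::nat) = \<one>\<^bsub>torus\<^esub> \<longleftrightarrow> (\<forall>i. of_nat N * v $ i \<in> \<int>)"
  by (simp add: pow_torus one_torus lattice_coset_eq_iff)

text \<open>
  A point of order dividing \<open>N\<close> has a representative with coordinates among
  \<open>0, 1/N, \<dots>, (N - 1)/N\<close>.
\<close>

lemma finite_torsion_torus:
  assumes "N > 0"
  shows "finite {X \<in> carrier (torus :: (real^'r) set monoid). X [^]\<^bsub>torus\<^esub> (N::nat) = \<one>\<^bsub>torus\<^esub>}"
proof -
  let ?C = "(UNIV :: 'r set) \<rightarrow>\<^sub>E {0..<int N}"
  have "X \<in> (\<lambda>c. lattice_coset (\<chi> i. of_int (c i) / of_nat N)) ` ?C"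
    if "X \<in> carrier torus" "X [^]\<^bsub>torus\<^esub> N = \<one>\<^bsub>torus\<^esub>" for X :: "(real^'r) set"
  proof -
    from that obtain v where X: "X = lattice_coset v" and "\<forall>i. of_nat N * v $ i \<in> \<int>"
      by (auto simp: carrier_torus pow_torus_eq_one_iff)
    then obtain z where z: "\<And>i. of_nat N * v $ i = of_int (z i)"
      unfolding Ints_def image_iff Bex_def by metis
    have "v $ i - of_int (z i mod int N) / of_nat N = of_int (z i div int N)" for i
    proof -
      have "of_nat N * v $ i = of_nat N * of_int (z i div int N) + of_int (z i mod int N)"
        by (metis z mult_div_mod_eq of_int_add of_int_mult of_int_of_nat_eq)
      then show ?thesis using assms by (simp add: field_simps)
    qed
    then have "X = lattice_coset (\<chi> i. of_int (z i mod int N) / of_nat N)"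
      by (simp add: X lattice_coset_eq_iff)
    moreover have "(\<lambda>i. z i mod int N) \<in> ?C" using assms by auto
    ultimately show ?thesis by (rule image_eqI)
  qed
  then have "{X \<in> carrier (torus :: (real^'r) set monoid). X [^]\<^bsub>torus\<^esub> N = \<one>\<^bsub>torus\<^esub>}
      \<subseteq> (\<lambda>c. lattice_coset (\<chi> i. of_int (c i) / of_nat N)) ` ?C"
    by blast
  moreover have "finite ?C" by (simp add: finite_PiE)
  ultimately show ?thesis by (rule finite_subset[OF _ finite_imageI])
qed

text \<open>
  An endomorphism maps the \<open>N\<close>-torsion into itself, and an injective self-map of a finite set
  is onto.
\<close>

lemma torsion_in_range_of_injective_endomorphism:
  assumes "group G" and hom: "\<eta> \<in> hom G G" and inj: "inj_on \<eta> (carrier G)"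
    and fin: "finite {x \<in> carrier G. x [^]\<^bsub>G\<^esub> (N::nat) = \<one>\<^bsub>G\<^esub>}"
    and x: "x \<in> carrier G" "x [^]\<^bsub>G\<^esub> N = \<one>\<^bsub>G\<^esub>"
  shows "x \<in> \<eta> ` carrier G"
proof -
  interpret group_hom G G \<eta>
    using assms by (simp add: group_hom_def group_hom_axioms_def)
  let ?T = "{x \<in> carrier G. x [^]\<^bsub>G\<^esub> N = \<one>\<^bsub>G\<^esub>}"
  have "\<eta> ` ?T \<subseteq> ?T" by (auto simp flip: hom_nat_pow)
  moreover have "inj_on \<eta> ?T" using inj by (rule inj_on_subset) auto
  ultimately have "\<eta> ` ?T = ?T" by (rule endo_inj_surj[OF fin])
  with x show ?thesis by blast
qed

text \<open>
  The point with single nonzero coordinate \<open>1/N\<close> at \<open>a\<close> pairs with \<open>q\<close> to \<open>q a / N\<close>, which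
  lies strictly between \<open>-1\<close> and \<open>1\<close> and is not \<open>0\<close> once \<open>N\<close> exceeds the absolute value of \<open>q a\<close>.
\<close>

lemma torsion_point_off_integer_hyperplanes:
  fixes q :: "'r::finite \<Rightarrow> int"
  assumes "q a \<noteq> 0"
  obtains N :: nat and v :: "real^'r" where "N > 0"
    "lattice_coset v [^]\<^bsub>torus\<^esub> N = \<one>\<^bsub>torus\<^esub>"
    "(\<Sum>i\<in>UNIV. of_int (q i) * v $ i) \<notin> \<int>"
proof -
  define N where "N = nat (\<bar>q a\<bar> + 1)"
  have N: "N > 0" "int N = \<bar>q a\<bar> + 1" by (simp_all add: N_def)
  define v where "v = (axis a (1 / of_nat N) :: real^'r)"
  have sum: "(\<Sum>i\<in>UNIV. of_int (q i) * v $ i) = of_int (q a) / of_nat N"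
    by (simp add: v_def axis_def if_distrib[where f="\<lambda>x. _ * x"] cong: if_cong)
  have "(\<Sum>i\<in>UNIV. of_int (q i) * v $ i) \<notin> \<int>"
  proof
    assume "(\<Sum>i\<in>UNIV. of_int (q i) * v $ i) \<in> \<int>"
    then obtain z where "of_int (q a) / of_nat N = (of_int z :: real)"
      unfolding sum by (auto elim: Ints_cases)
    then have "(of_int (q a) :: real) = of_int (z * int N)"
      using N(1) by (simp add: field_simps)
    then have "q a = z * int N" by linarith
    then have "int N dvd \<bar>q a\<bar>" by simp
    then have "int N \<le> \<bar>q a\<bar>" using assms by (intro zdvd_imp_le) simp_all
    with N(2) show False by simp
  qed
  moreover have "lattice_coset v [^]\<^bsub>torus\<^esub> N = \<one>\<^bsub>torus\<^esub>"
    using N(1) by (simp add: pow_torus_eq_one_iff v_def axis_def)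
  ultimately show thesis using that N(1) by blast
qed

section \<open>The standard part modulo the integer lattice\<close>

text \<open>
  The value is the set of all standard parts of \<open>\<Theta> n - m\<close> over the hyperinteger vectors \<open>m\<close>, so
  it is literally a coset of the lattice and no representative has to be chosen.
\<close>

definition standard_part_mod_lattice ::
  "nat filter \<Rightarrow> real^'s^'r \<Rightarrow> ('s \<Rightarrow> (nat \<Rightarrow> int) set) \<Rightarrow> (real^'r) set" where
  "standard_part_mod_lattice U \<Theta> n =
     {v. \<exists>f m. n = (\<lambda>j. ultra_class U (f j)) \<and>
        (\<forall>i. ((\<lambda>k. (\<Sum>j\<in>UNIV. \<Theta> $ i $ j * of_int (f j k)) - of_int (m i k)) \<longlongrightarrow> v $ i) U)}"

lemma standard_part_mod_lattice_class:
  "v \<in> standard_part_mod_lattice U \<Theta> (\<lambda>j. ultra_class U (f j)) \<longleftrightarrow>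
   (\<exists>m. \<forall>i. ((\<lambda>k. (\<Sum>j\<in>UNIV. \<Theta> $ i $ j * of_int (f j k)) - of_int (m i k)) \<longlongrightarrow> v $ i) U)"
proof
  assume "v \<in> standard_part_mod_lattice U \<Theta> (\<lambda>j. ultra_class U (f j))"
  then obtain g m where "(\<lambda>j. ultra_class U (f j)) = (\<lambda>j. ultra_class U (g j))"
    and lim: "\<forall>i. ((\<lambda>k. (\<Sum>j\<in>UNIV. \<Theta> $ i $ j * of_int (g j k)) - of_int (m i k)) \<longlongrightarrow> v $ i) U"
    unfolding standard_part_mod_lattice_def by blast
  then have "\<forall>j. \<forall>\<^sub>F k in U. f j k = g j k" by (simp add: fun_eq_iff)
  then have "\<forall>\<^sub>F k in U. \<forall>j. f j k = g j k" by (simp add: eventually_all_finite)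
  then have "((\<lambda>k. (\<Sum>j\<in>UNIV. \<Theta> $ i $ j * of_int (f j k)) - of_int (m i k)) \<longlongrightarrow> v $ i) U" for i
    using lim[rule_format, of i] by (rule_tac Lim_transform_eventually) (auto elim: eventually_mono)
  then show "\<exists>m. \<forall>i. ((\<lambda>k. (\<Sum>j\<in>UNIV. \<Theta> $ i $ j * of_int (f j k)) - of_int (m i k)) \<longlongrightarrow> v $ i) U"
    by blast
qed (auto simp: standard_part_mod_lattice_def)

text \<open>
  Two such limits differ by a limit of integers, which is an integer because the integers are
  closed.
\<close>

lemma standard_part_mod_lattice_is_coset:
  fixes \<Theta> :: "real^'s^'r"
  assumes U: "nonprincipal_ultrafilter U" and v: "v \<in> standard_part_mod_lattice U \<Theta> n"
  shows "standard_part_mod_lattice U \<Theta> n = lattice_coset v"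
proof -
  from v obtain f m where n: "n = (\<lambda>j. ultra_class U (f j))" and
    m: "\<And>i. ((\<lambda>k. (\<Sum>j\<in>UNIV. \<Theta> $ i $ j * of_int (f j k)) - of_int (m i k)) \<longlongrightarrow> v $ i) U"
    unfolding standard_part_mod_lattice_def by blast
  have "U \<noteq> bot" using U by (simp add: nonprincipal_ultrafilter_def)
  show ?thesis
  proof (intro Set.set_eqI iffI)
    fix w assume "w \<in> standard_part_mod_lattice U \<Theta> n"
    then obtain m' where
      m': "\<And>i. ((\<lambda>k. (\<Sum>j\<in>UNIV. \<Theta> $ i $ j * of_int (f j k)) - of_int (m' i k)) \<longlongrightarrow> w $ i) U"
      unfolding n standard_part_mod_lattice_class by blast
    have "((\<lambda>k. of_int (m i k - m' i k)) \<longlongrightarrow> w $ i - v $ i) U" for i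
      using tendsto_diff[OF m'[of i] m[of i]] by simp
    then have "w $ i - v $ i \<in> \<int>" for i
      by (rule Lim_in_closed_set[OF closed_Ints always_eventually \<open>U \<noteq> bot\<close>, rotated]) simp
    then show "w \<in> lattice_coset v"
      unfolding in_lattice_coset_iff by blast
  next
    fix w assume "w \<in> lattice_coset v"
    then obtain z where z: "\<And>i. w $ i - v $ i = of_int (z i)"
      unfolding in_lattice_coset_iff Ints_def image_iff Bex_def by metis
    have "((\<lambda>k. (\<Sum>j\<in>UNIV. \<Theta> $ i $ j * of_int (f j k)) - of_int (m i k - z i)) \<longlongrightarrow> w $ i) U" for i
      using tendsto_add[OF m[of i] tendsto_const[of "of_int (z i)"]] z[of i] by (simp add: algebra_simps)
    then show "w \<in> standard_part_mod_lattice U \<Theta> n"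
      unfolding n standard_part_mod_lattice_class by (intro exI[of _ "\<lambda>i k. m i k - z i"]) blast
  qed
qed

text \<open>
  The integer parts of \<open>\<Theta> n\<close> serve as \<open>m\<close>: the fractional parts that remain are bounded.
\<close>

lemma standard_part_mod_lattice_nonempty:
  fixes \<Theta> :: "real^'s^'r" and n :: "'s \<Rightarrow> (nat \<Rightarrow> int) set"
  assumes U: "nonprincipal_ultrafilter U" and "n \<in> carrier (hyperint_vectors U)"
  obtains v where "v \<in> standard_part_mod_lattice U \<Theta> n"
proof -
  from assms(2) obtain f where n: "n = (\<lambda>j. ultra_class U (f j))"
    by (auto simp: carrier_hyperint_vectors)
  define x where "x k i = (\<Sum>j\<in>UNIV. \<Theta> $ i $ j * of_int (f j k))" for k i
  have "\<exists>l. ((\<lambda>k. frac (x k i)) \<longlongrightarrow> l) U" for i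
  proof -
    have "bounded (range (\<lambda>k. frac (x k i)))"
      by (auto simp: bounded_iff intro!: exI[of _ 1] less_imp_le[OF frac_lt_1])
    then show ?thesis using ultrafilter_bounded_convergent[OF U] by metis
  qed
  then obtain l where "\<And>i. ((\<lambda>k. x k i - of_int \<lfloor>x k i\<rfloor>) \<longlongrightarrow> l i) U"
    unfolding frac_def by metis
  then have "(\<chi> i. l i) \<in> standard_part_mod_lattice U \<Theta> n"
    unfolding n standard_part_mod_lattice_class x_def
    by (intro exI[of _ "\<lambda>i k. \<lfloor>\<Sum>j\<in>UNIV. \<Theta> $ i $ j * of_int (f j k)\<rfloor>"]) simp
  with that show thesis .
qed

lemma standard_part_mod_lattice_hom:
  fixes \<Theta> :: "real^'s^'r"
  assumes U: "nonprincipal_ultrafilter U"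
  shows "standard_part_mod_lattice U \<Theta> \<in> hom (hyperint_vectors U) torus"
proof (rule homI)
  fix n :: "'s \<Rightarrow> (nat \<Rightarrow> int) set" assume "n \<in> carrier (hyperint_vectors U)"
  then show "standard_part_mod_lattice U \<Theta> n \<in> carrier torus"
    by (metis standard_part_mod_lattice_nonempty[OF U] standard_part_mod_lattice_is_coset[OF U]
        carrier_torus rangeI)
next
  fix n n' :: "'s \<Rightarrow> (nat \<Rightarrow> int) set" assume n: "n \<in> carrier (hyperint_vectors U)" "n' \<in> carrier (hyperint_vectors U)"
  then obtain v v' where v: "v \<in> standard_part_mod_lattice U \<Theta> n" "v' \<in> standard_part_mod_lattice U \<Theta> n'"
    using standard_part_mod_lattice_nonempty[OF U] by metis
  obtain f m where f: "n = (\<lambda>j. ultra_class U (f j))"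
    and m: "\<And>i. ((\<lambda>k. (\<Sum>j\<in>UNIV. \<Theta> $ i $ j * of_int (f j k)) - of_int (m i k)) \<longlongrightarrow> v $ i) U"
    using v(1) unfolding standard_part_mod_lattice_def by blast
  obtain f' m' where f': "n' = (\<lambda>j. ultra_class U (f' j))"
    and m': "\<And>i. ((\<lambda>k. (\<Sum>j\<in>UNIV. \<Theta> $ i $ j * of_int (f' j k)) - of_int (m' i k)) \<longlongrightarrow> v' $ i) U"
    using v(2) unfolding standard_part_mod_lattice_def by blast
  have "((\<lambda>k. (\<Sum>j\<in>UNIV. \<Theta> $ i $ j * of_int (f j k + f' j k)) - of_int (m i k + m' i k)) \<longlongrightarrow> (v + v') $ i) U" for i
    using tendsto_add[OF m[of i] m'[of i]] by (simp add: algebra_simps sum.distrib)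
  then have "v + v' \<in> standard_part_mod_lattice U \<Theta> (n \<otimes>\<^bsub>hyperint_vectors U\<^esub> n')"
    unfolding f f' mult_hyperint_vectors standard_part_mod_lattice_class
    by (intro exI[of _ "\<lambda>i k. m i k + m' i k"]) blast
  then show "standard_part_mod_lattice U \<Theta> (n \<otimes>\<^bsub>hyperint_vectors U\<^esub> n') =
      standard_part_mod_lattice U \<Theta> n \<otimes>\<^bsub>torus\<^esub> standard_part_mod_lattice U \<Theta> n'"
    using v[THEN standard_part_mod_lattice_is_coset[OF U]]
    by (simp only: mult_torus) (rule standard_part_mod_lattice_is_coset[OF U])
qed

lemma kernel_standard_part_mod_lattice:
  fixes \<Theta> :: "real^'s^'r"
  assumes U: "nonprincipal_ultrafilter U"
  shows "kernel (hyperint_vectors U) torus (standard_part_mod_lattice U \<Theta>) = diophantine_approximation_group U \<Theta>"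
proof -
  have "standard_part_mod_lattice U \<Theta> n = \<one>\<^bsub>torus\<^esub> \<longleftrightarrow> 0 \<in> standard_part_mod_lattice U \<Theta> n" for n
  proof
    assume "standard_part_mod_lattice U \<Theta> n = \<one>\<^bsub>torus\<^esub>"
    then show "0 \<in> standard_part_mod_lattice U \<Theta> n" by (simp add: one_torus in_lattice_coset_iff)
  next
    assume "0 \<in> standard_part_mod_lattice U \<Theta> n"
    then show "standard_part_mod_lattice U \<Theta> n = \<one>\<^bsub>torus\<^esub>"
      unfolding one_torus by (rule standard_part_mod_lattice_is_coset[OF U])
  qed
  then have ker: "kernel (hyperint_vectors U) torus (standard_part_mod_lattice U \<Theta>) =
      {n \<in> carrier (hyperint_vectors U). 0 \<in> standard_part_mod_lattice U \<Theta> n}"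
    by (simp add: kernel_def)
  have "0 \<in> standard_part_mod_lattice U \<Theta> n \<longleftrightarrow> n \<in> diophantine_approximation_group U \<Theta>"
    if n: "n \<in> carrier (hyperint_vectors U)" for n
  proof -
    obtain f where "n = (\<lambda>j. ultra_class U (f j))"
      using n by (auto simp: carrier_hyperint_vectors)
    then show ?thesis
      by (simp add: diophantine_approximation_group_class standard_part_mod_lattice_class)
  qed
  moreover have "diophantine_approximation_group U \<Theta> \<subseteq> carrier (hyperint_vectors U)"
    by (auto simp: diophantine_approximation_group_def)
  ultimately show ?thesis unfolding ker by blast
qed

text \<open>
  The \<open>k\<close>-th entry of a preimage approximates the given point up to \<open>1/(k + 1)\<close>, by
  Kronecker's theorem.
\<close>

lemma standard_part_mod_lattice_onto:
  fixes \<Theta> :: "real^'s^'r"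
  assumes U: "nonprincipal_ultrafilter U" and ind: "inhomogeneously_independent \<Theta>"
  shows "standard_part_mod_lattice U \<Theta> ` carrier (hyperint_vectors U) = carrier torus"
proof (intro equalityI subsetI)
  fix X :: "(real^'r) set" assume "X \<in> carrier torus"
  then obtain v where X: "X = lattice_coset v" by (auto simp: carrier_torus)
  have "\<exists>n m. \<forall>i. \<bar>(\<Sum>j\<in>UNIV. \<Theta> $ i $ j * of_int (n j)) - of_int (m i) - v $ i\<bar> < inverse (of_nat (Suc k))" for k
    using Kronecker_matrix[OF ind, of "inverse (of_nat (Suc k))" "\<lambda>i. v $ i"]
    by (metis inverse_positive_iff_positive of_nat_0_less_iff zero_less_Suc)
  then obtain n m where nm: "\<And>k i. \<bar>(\<Sum>j\<in>UNIV. \<Theta> $ i $ j * of_int (n k j)) - of_int (m k i) - v $ i\<bar> < inverse (of_nat (Suc k))"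
    by metis
  have "((\<lambda>k. (\<Sum>j\<in>UNIV. \<Theta> $ i $ j * of_int (n k j)) - of_int (m k i)) \<longlonglongrightarrow> v $ i)" for i
    by (rule LIM_zero_cancel, rule Lim_null_comparison[OF _ LIMSEQ_inverse_real_of_nat])
      (use nm in \<open>auto intro!: always_eventually less_imp_le\<close>)
  then have "((\<lambda>k. (\<Sum>j\<in>UNIV. \<Theta> $ i $ j * of_int (n k j)) - of_int (m k i)) \<longlongrightarrow> v $ i) U" for i
    using tendsto_mono[OF nonprincipal_ultrafilter_le_sequentially[OF U]] by blast
  then have "v \<in> standard_part_mod_lattice U \<Theta> (\<lambda>j. ultra_class U (\<lambda>k. n k j))"
    unfolding standard_part_mod_lattice_class by (intro exI[of _ "\<lambda>i k. m k i"]) blast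
  then have "X = standard_part_mod_lattice U \<Theta> (\<lambda>j. ultra_class U (\<lambda>k. n k j))"
    using standard_part_mod_lattice_is_coset[OF U] X by blast
  moreover have "(\<lambda>j. ultra_class U (\<lambda>k. n k j)) \<in> carrier (hyperint_vectors U)"
    unfolding carrier_hyperint_vectors by (rule range_eqI[of _ _ "\<lambda>j k. n k j"]) simp
  ultimately show "X \<in> standard_part_mod_lattice U \<Theta> ` carrier (hyperint_vectors U)" by blast
next
  fix X assume "X \<in> standard_part_mod_lattice U \<Theta> ` carrier (hyperint_vectors U)"
  then show "X \<in> carrier torus"
    using standard_part_mod_lattice_hom[OF U, of \<Theta>] by (auto simp: hom_def)
qed

text \<open>
  The integer combination \<open>q\<close> of \<open>\<Theta> n - m\<close> is an integer at every index, hence so is its limit.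
\<close>

lemma integer_relation_standard_part:
  fixes \<Theta> :: "real^'s^'r" and q :: "'r \<Rightarrow> int"
  assumes U: "nonprincipal_ultrafilter U"
    and rel: "\<And>j. (\<Sum>i\<in>UNIV. of_int (q i) * \<Theta> $ i $ j) \<in> \<int>"
    and v: "v \<in> standard_part_mod_lattice U \<Theta> n"
  shows "(\<Sum>i\<in>UNIV. of_int (q i) * v $ i) \<in> \<int>"
proof -
  from v obtain f m where
    m: "\<And>i. ((\<lambda>k. (\<Sum>j\<in>UNIV. \<Theta> $ i $ j * of_int (f j k)) - of_int (m i k)) \<longlongrightarrow> v $ i) U"
    unfolding standard_part_mod_lattice_def by blast
  let ?g = "\<lambda>k. \<Sum>i\<in>UNIV. of_int (q i) * ((\<Sum>j\<in>UNIV. \<Theta> $ i $ j * of_int (f j k)) - of_int (m i k))"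
  have "(?g \<longlongrightarrow> (\<Sum>i\<in>UNIV. of_int (q i) * v $ i)) U"
    by (intro tendsto_intros m)
  moreover have "?g k \<in> \<int>" for k
  proof -
    have "(\<Sum>i\<in>UNIV. of_int (q i) * (\<Sum>j\<in>UNIV. \<Theta> $ i $ j * of_int (f j k))) =
        (\<Sum>j\<in>UNIV. of_int (f j k) * (\<Sum>i\<in>UNIV. of_int (q i) * \<Theta> $ i $ j))"
      unfolding sum_distrib_left by (subst sum.swap) (simp add: mult_ac)
    then have "?g k = (\<Sum>j\<in>UNIV. of_int (f j k) * (\<Sum>i\<in>UNIV. of_int (q i) * \<Theta> $ i $ j))
        - (\<Sum>i\<in>UNIV. of_int (q i) * of_int (m i k))"
      by (simp add: right_diff_distrib sum_subtractf)
    then show ?thesis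
      by (simp only:) (intro Ints_diff Ints_sum Ints_mult Ints_of_int rel)
  qed
  ultimately show ?thesis
    using U by (intro Lim_in_closed_set[OF closed_Ints, of ?g U]) (auto simp: nonprincipal_ultrafilter_def)
qed

section \<open>The quotient and the torus\<close>

theorem theorem9:
  fixes U :: "nat filter" and \<Theta> :: "real^'s^'r"
  assumes "nonprincipal_ultrafilter U"
  shows "inhomogeneously_independent \<Theta> \<longleftrightarrow>
    hyperint_vectors U Mod diophantine_approximation_group U \<Theta> \<cong> (torus :: (real^'r) set monoid)"
proof -
  let ?H = "hyperint_vectors U :: ('s \<Rightarrow> (nat \<Rightarrow> int) set) monoid"
  let ?T = "torus :: (real^'r) set monoid"
  let ?h = "standard_part_mod_lattice U \<Theta>"
  let ?Q = "?H Mod diophantine_approximation_group U \<Theta>"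
  interpret h: group_hom ?H ?T ?h
    by (simp add: group_hom_def group_hom_axioms_def group_hyperint_vectors group_torus
        standard_part_mod_lattice_hom[OF assms])
  have ker: "kernel ?H ?T ?h = diophantine_approximation_group U \<Theta>"
    by (rule kernel_standard_part_mod_lattice[OF assms])
  show ?thesis
  proof
    assume "inhomogeneously_independent \<Theta>"
    then show "?Q \<cong> ?T"
      using h.FactGroup_iso[OF standard_part_mod_lattice_onto[OF assms]] by (simp add: ker)
  next
    assume iso: "?Q \<cong> ?T"
    show "inhomogeneously_independent \<Theta>"
    proof (rule ccontr)
      assume "\<not> inhomogeneously_independent \<Theta>"
      then obtain q :: "'r \<Rightarrow> int" and a where
        rel: "\<And>j. (\<Sum>i\<in>UNIV. of_int (q i) * \<Theta> $ i $ j) \<in> \<int>" and a: "q a \<noteq> 0"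
        unfolding inhomogeneously_independent_iff by blast
      have "group ?Q"
        using normal.factorgroup_is_group[OF h.normal_kernel] by (simp add: ker)
      with iso obtain \<phi> where \<phi>: "\<phi> \<in> iso ?T ?Q"
        using group.iso_sym unfolding is_iso_def by blast
      \<comment> \<open>The embedding of the quotient into the torus induced by the standard part.\<close>
      define \<psi> where "\<psi> X = the_elem (?h ` X)" for X
      have \<psi>: "\<psi> \<in> hom ?Q ?T" "inj_on \<psi> (carrier ?Q)"
        using h.FactGroup_hom h.FactGroup_inj_on unfolding ker \<psi>_def by blast+
      have \<psi>_range: "\<psi> X \<in> ?h ` carrier ?H" if X: "X \<in> carrier ?Q" for X
      proof -
        have "X \<in> carrier (?H Mod kernel ?H ?T ?h)" using X by (simp only: ker)
        then obtain g where g: "g \<in> carrier ?H" "X = kernel ?H ?T ?h #>\<^bsub>?H\<^esub> g"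
          by (auto simp: carrier_FactGroup)
        then have "?h ` X = {?h g}" by (auto simp: kernel_def r_coset_def intro!: imageI)
        with g show ?thesis by (simp add: \<psi>_def)
      qed
      have hom: "\<psi> \<circ> \<phi> \<in> hom ?T ?T" and inj: "inj_on (\<psi> \<circ> \<phi>) (carrier ?T)"
        using \<phi> \<psi> by (auto simp: iso_def bij_betw_def intro: hom_compose comp_inj_on)
      obtain N :: nat and v :: "real^'r" where N: "N > 0"
        and v: "lattice_coset v [^]\<^bsub>?T\<^esub> N = \<one>\<^bsub>?T\<^esub>"
          "(\<Sum>i\<in>UNIV. of_int (q i) * v $ i) \<notin> \<int>"
        using torsion_point_off_integer_hyperplanes[of q a, OF a] by blast
      have "lattice_coset v \<in> carrier ?T" by (simp add: carrier_torus)
      then have "lattice_coset v \<in> (\<psi> \<circ> \<phi>) ` carrier ?T"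
        using torsion_in_range_of_injective_endomorphism[OF group_torus hom inj finite_torsion_torus[OF N]] v(1)
        by blast
      then obtain Y where "Y \<in> carrier ?T" "lattice_coset v = \<psi> (\<phi> Y)" by auto
      moreover have "\<phi> Y \<in> carrier ?Q"
        using \<phi> \<open>Y \<in> carrier ?T\<close> by (auto simp: iso_def hom_def)
      ultimately obtain n where "lattice_coset v = ?h n" using \<psi>_range by blast
      then have "v \<in> ?h n" by (simp add: in_lattice_coset_iff flip: \<open>lattice_coset v = ?h n\<close>)
      with v(2) show False
        using integer_relation_standard_part[OF assms rel] by blast
    qed
  qed
qed

end
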